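(* Let $s\ge 1$ be an integer, let $\omega_1,\ldots,\omega_s\in(0,+\infty)$, and set $\mathcal{S}=\{\omega_1,\ldots,\omega_s\}$. There is a constant $C>0$ depending only on $\mathcal{S}$ (in particular, independent of $N$) such that the following holds. Let $N\ge 1$, let $L_1,\ldots,L_N\subseteq\mathbb{R}^2$ be full-rank lattices satisfying $\mathrm{vol}(L_i)\in\mathcal{S}$ for $1\le i\le N$, and let $A_i\in\mathrm{GL}(2,\mathbb{R})$ be matrices such that $L_i=A_i\mathbb{Z}^2$. Then, for every $\varepsilon>0$, there exist matrices $B_i\in\mathrm{GL}(2,\mathbb{R})$ and $C_i\in\mathrm{SL}(2,\mathbb{Z})$ ($1\le i\le N$) and a nonnegative function $f\in L^1(\mathbb{R}^2)$ such that, with $\Lambda_i=B_i\mathbb{Z}^2$, $$\det B_i=\det A_i,\qquad \|B_i-A_iC_i\|_\infty\le\varepsilon\qquad(1\le i\le N),\qquad \Lambda_i\cap\Lambda_j=\{0\}\quad(i\ne j),$$ and $f$ tiles with each of $\Lambda_1,\ldots,\Lambda_N$ and satisfies $$\operatorname{diam}\operatorname{supp} f\le C\sqrt{N}.$$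
   Context: A full-rank lattice in $\mathbb{R}^2$ is a set $\Lambda=B\mathbb{Z}^2$ with $B\in\mathrm{GL}(2,\mathbb{R})$; its volume is $\mathrm{vol}(\Lambda)=|\det B|$. A function $f\in L^1(\mathbb{R}^2)$ tiles with $\Lambda$ if there is a nonzero constant $c$ (the level, which may depend on the lattice) such that $\sum_{\lambda\in\Lambda}f(x-\lambda)=c$ for almost every $x\in\mathbb{R}^2$. For a matrix $A=(a_{ij})$, $\|A\|_\infty:=\max_{i,j}|a_{ij}|$. Here $\operatorname{supp} f$ is the (essential) support of $f$ and $\operatorname{diam}$ is the Euclidean diameter. *)

theory Defs
  imports "HOL-Analysis.Analysis"
begin

definition lattice_of :: "real^2^2 \<Rightarrow> (real^2) set" where
  "lattice_of B = {B *v z |z. \<forall>i. z $ i \<in> \<int>}"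

definition full_rank_lattice :: "(real^2) set \<Rightarrow> bool" where
  "full_rank_lattice L \<longleftrightarrow> (\<exists>B. invertible B \<and> L = lattice_of B)"

text \<open>The description is proper for full-rank lattices; see \<open>lattice_volume_lattice_of\<close> below.\<close>

definition lattice_volume :: "(real^2) set \<Rightarrow> real" where
  "lattice_volume L = (THE v. \<exists>B. invertible B \<and> L = lattice_of B \<and> v = \<bar>det B\<bar>)"

definition entry_norm :: "real^2^2 \<Rightarrow> real" where
  "entry_norm M = Max {\<bar>M $ i $ j\<bar> |i j. True}"

definition tiles_with :: "(real^2 \<Rightarrow> real) \<Rightarrow> (real^2) set \<Rightarrow> bool" where
  "tiles_with f L \<longleftrightarrow>
     (\<exists>c. c \<noteq> 0 \<and> (AE x in lebesgue. ((\<lambda>l. f (x - l)) has_sum c) L))"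

text \<open>The essential support is the complement of the largest open set on which \<open>f\<close>
  vanishes almost everywhere, so it does not change if \<open>f\<close> is modified on a null set.\<close>

definition ess_supp :: "(real^2 \<Rightarrow> real) \<Rightarrow> (real^2) set" where
  "ess_supp f = - \<Union>{U. open U \<and> (AE x in lebesgue. x \<in> U \<longrightarrow> f x = 0)}"

lemma lattice_of_subset_det:
  assumes sub: "lattice_of B \<subseteq> lattice_of A"
  shows "\<exists>k\<in>\<int>. det B = det A * k"
proof -
  have "\<exists>z. (\<forall>i. z $ i \<in> \<int>) \<and> B *v axis j 1 = A *v z" for j
  proof -
    have "B *v axis j 1 \<in> lattice_of B"
      unfolding lattice_of_def mem_Collect_eq
      by (rule exI[where x = "axis j 1"]) (simp add: axis_def)
    then show ?thesis using sub unfolding lattice_of_def by blast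
  qed
  then obtain z where z: "\<And>j i. z j $ i \<in> \<int>" "\<And>j. B *v axis j 1 = A *v z j"
    by metis
  define M :: "real^2^2" where "M = (\<chi> i j. z j $ i)"
  have "B = A ** M"
  proof -
    have "B $ i $ j = (A ** M) $ i $ j" for i j
    proof -
      have "B $ i $ j = (B *v axis j 1) $ i"
        by (simp add: matrix_vector_mult_basis column_def)
      also have "\<dots> = (A *v z j) $ i" by (simp add: z)
      also have "\<dots> = (A ** M) $ i $ j"
        by (simp add: M_def matrix_matrix_mult_def matrix_vector_mult_def)
      finally show ?thesis .
    qed
    then show ?thesis by (simp add: vec_eq_iff)
  qed
  moreover have "det M \<in> \<int>"
    unfolding det_2 M_def vec_lambda_beta by (intro Ints_diff Ints_mult z)
  ultimately show ?thesis by (auto simp only: det_mul)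
qed

lemma abs_det_lattice_of_eq:
  assumes "invertible A" "invertible B" "lattice_of A = lattice_of B"
  shows "\<bar>det A\<bar> = \<bar>det B\<bar>"
proof -
  have nz: "det A \<noteq> 0" "det B \<noteq> 0"
    using assms by (simp_all add: invertible_det_nz)
  have le: "\<bar>b\<bar> \<le> \<bar>a\<bar>" if "a = b * k" "k \<in> \<int>" "a \<noteq> 0" for a b k :: real
  proof -
    have "1 \<le> \<bar>k\<bar>" using that by (intro Ints_nonzero_abs_ge1) auto
    then have "\<bar>b\<bar> * 1 \<le> \<bar>b\<bar> * \<bar>k\<bar>" by (intro mult_left_mono) auto
    then show ?thesis using that by (simp add: abs_mult)
  qed
  obtain k where k: "k \<in> \<int>" "det B = det A * k"
    using lattice_of_subset_det[of B A] assms(3) by blast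
  obtain m where m: "m \<in> \<int>" "det A = det B * m"
    using lattice_of_subset_det[of A B] assms(3) by blast
  show ?thesis
    by (rule order_antisym[OF le[OF k(2,1) nz(2)] le[OF m(2,1) nz(1)]])
qed

lemma lattice_volume_lattice_of:
  assumes "invertible A"
  shows "lattice_volume (lattice_of A) = \<bar>det A\<bar>"
  unfolding lattice_volume_def
proof (rule the_equality)
  show "\<exists>B. invertible B \<and> lattice_of A = lattice_of B \<and> \<bar>det A\<bar> = \<bar>det B\<bar>"
    using assms by blast
next
  fix v
  assume "\<exists>B. invertible B \<and> lattice_of A = lattice_of B \<and> v = \<bar>det B\<bar>"
  then obtain B where "invertible B" "lattice_of A = lattice_of B" "v = \<bar>det B\<bar>"
    by blast
  then show "v = \<bar>det A\<bar>"
    using abs_det_lattice_of_eq[OF assms, of B] by simp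
qed

end

theory Submission
  imports Defs
begin

text \<open>
  Write \<open>w \<times> v\<close> for the determinant with columns \<open>w\<close> and \<open>v\<close>. The parallelogram spanned by \<open>w\<close>
  and \<open>v\<close> tiles with the lattice generated by \<open>w\<close> and \<open>v\<close>, but also with every lattice generated
  by \<open>w\<close> and \<open>\<plusminus>v + \<tau> w\<close>: sliding a row of tiles along \<open>w\<close> does no harm. So one vector \<open>v\<close> can serve
  all the lattices, and the only condition on a lattice generated by \<open>w\<close> and \<open>b\<close> is
  \<open>\<bar>w \<times> v\<bar> = \<bar>w \<times> b\<bar>\<close>, which is its volume. Take \<open>v = (0, \<surd>N)\<close>. A lattice of volume \<open>\<omega>\<close> is then
  served if it has a primitive vector \<open>w\<close> with first coordinate \<open>\<omega> / \<surd>N\<close>, and this vector may be as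
  short as \<open>O(1 / \<surd>N)\<close>. Given \<open>N\<close> such lattices, with vectors \<open>w\<^sub>1, \<dots>, w\<^sub>N\<close>, start from a continuous nonnegative compactly
  supported function and average it along the segment \<open>v\<close> and along each segment \<open>w\<^sub>i\<close>. The support
  grows by \<open>\<surd>N + \<Sum> \<bar>w\<^sub>i\<bar> = O(\<surd>N)\<close>. Averaging along \<open>w\<close> makes a function \<^emph>\<open>flat\<close> along \<open>w\<close>, meaning
  that on each line parallel to \<open>w\<close> it tiles with the multiples of \<open>w\<close>, and further averaging keeps
  this (\<open>flat_along_segment_average_self\<close>, \<open>flat_along_segment_average\<close>). Flatness along both \<open>w\<close>
  and \<open>v\<close> gives the tiling (\<open>lattice_tiling_if_flat\<close>).

  It remains to move the given lattices into this narrow position. The closeness \<open>B \<approx> A C\<close> is required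
  only in one basis, and this basis may be very long: if \<open>b\<^sub>1 = k b\<^sub>2 + w\<close> with \<open>k\<close> large, a change of
  order \<open>1 / k\<close> in \<open>b\<^sub>2\<close>, with \<open>b\<^sub>1\<close> kept, changes \<open>w\<close> by an amount of order 1. In this way a
  primitive vector \<open>u\<close> of the given lattice is traded for an arbitrary short \<open>w\<close>, subject to one
  equation that keeps the determinant (\<open>approximate_by_narrow_basis\<close>). Finally, small vertical shears
  preserve the first coordinates, and generic ones make the lattices intersect trivially as long as
  no lattice contains a vertical vector (\<open>generic_shears\<close>).
\<close>

section \<open>Averaging along segments and flatness along lines\<close>

definition segment_average :: "'a::real_normed_vector \<Rightarrow> ('a \<Rightarrow> real) \<Rightarrow> 'a \<Rightarrow> real" where
  "segment_average w g x = integral {0..1} (\<lambda>t. g (x - t *\<^sub>R w))"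

definition line_sum :: "'a::real_normed_vector \<Rightarrow> ('a \<Rightarrow> real) \<Rightarrow> 'a \<Rightarrow> real" where
  "line_sum w f x = (\<Sum>\<^sub>\<infinity>m::int. f (x - of_int m *\<^sub>R w))"

text \<open>On each line parallel to \<open>w\<close>, the translates of \<open>f\<close> by the integer multiples of \<open>w\<close> add up to
  a constant; the constant may differ from line to line.\<close>

definition flat_along :: "'a::real_normed_vector \<Rightarrow> ('a \<Rightarrow> real) \<Rightarrow> bool" where
  "flat_along w f \<longleftrightarrow> (\<forall>x \<tau>. line_sum w f (x - \<tau> *\<^sub>R w) = line_sum w f x)"

definition supported_in_ball :: "real \<Rightarrow> ('a::real_normed_vector \<Rightarrow> real) \<Rightarrow> bool" where
  "supported_in_ball R f \<longleftrightarrow> (\<forall>x. f x \<noteq> 0 \<longrightarrow> norm x \<le> R)"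

lemma supported_in_ballD: "supported_in_ball R f \<Longrightarrow> R < norm x \<Longrightarrow> f x = 0"
  unfolding supported_in_ball_def by force

lemma continuous_on_segment_average:
  fixes g :: "'a::real_normed_vector \<Rightarrow> real"
  assumes "continuous_on UNIV g"
  shows "continuous_on UNIV (segment_average w g)"
proof -
  have "continuous_on (UNIV \<times> cbox 0 1) (\<lambda>(x, t). g (x - t *\<^sub>R w))"
    unfolding split_beta
    by (rule continuous_on_compose2[OF assms]) (auto intro!: continuous_intros)
  from integral_continuous_on_param[OF this] show ?thesis
    by (simp add: segment_average_def[abs_def])
qed

lemma continuous_on_segment:
  fixes g :: "'a::real_normed_vector \<Rightarrow> real"
  assumes "continuous_on UNIV g"
  shows "continuous_on T (\<lambda>t. g (x - t *\<^sub>R w))"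
  by (rule continuous_on_compose2[OF assms]) (auto intro!: continuous_intros)

lemma segment_average_nonneg:
  fixes g :: "'a::real_normed_vector \<Rightarrow> real"
  assumes "continuous_on UNIV g" "\<And>x. 0 \<le> g x"
  shows "0 \<le> segment_average w g x"
  unfolding segment_average_def using assms(2)
  by (intro integral_nonneg integrable_continuous_real continuous_on_segment assms(1)) auto

lemma segment_average_pos:
  fixes g :: "'a::real_normed_vector \<Rightarrow> real"
  assumes "continuous_on UNIV g" "\<And>x. 0 \<le> g x" "0 < g x"
  shows "0 < segment_average w g x"
proof -
  have "integral {0..1} (\<lambda>t. g (x - t *\<^sub>R w)) \<noteq> 0"
  proof
    assume "integral {0..1} (\<lambda>t. g (x - t *\<^sub>R w)) = 0"
    then have "\<forall>t\<in>{0..1::real}. g (x - t *\<^sub>R w) = 0"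
      by (subst (asm) integral_eq_0_iff) (use assms continuous_on_segment in auto)
    from bspec[OF this, of 0] show False using assms(3) by simp
  qed
  then show ?thesis
    using segment_average_nonneg[of g w x, OF assms(1,2)] by (simp add: segment_average_def)
qed

lemma supported_in_ball_segment_average:
  assumes "supported_in_ball R g"
  shows "supported_in_ball (R + norm w) (segment_average w g)"
  unfolding supported_in_ball_def
proof (intro allI impI, rule ccontr)
  fix x
  assume ne: "segment_average w g x \<noteq> 0" and "\<not> norm x \<le> R + norm w"
  have "g (x - t *\<^sub>R w) = 0" if "t \<in> {0..1}" for t
  proof (rule supported_in_ballD[OF assms])
    have "norm (t *\<^sub>R w) \<le> norm w" using that by (simp add: mult_left_le_one_le)
    moreover have "norm x - norm (t *\<^sub>R w) \<le> norm (x - t *\<^sub>R w)" by (rule norm_triangle_ineq2)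
    ultimately show "R < norm (x - t *\<^sub>R w)" using \<open>\<not> norm x \<le> R + norm w\<close> by linarith
  qed
  then have "integral {0..1} (\<lambda>t. g (x - t *\<^sub>R w)) = integral {0..1} (\<lambda>t::real. 0)"
    by (intro integral_cong) auto
  then show False using ne by (simp add: segment_average_def)
qed

lemma vanishes_far_along_line:
  assumes "supported_in_ball R f" "w \<noteq> 0" "(R + norm x) / norm w < \<bar>s\<bar>"
  shows "f (x - s *\<^sub>R w) = 0"
proof (rule supported_in_ballD[OF assms(1)])
  have "R + norm x < norm (s *\<^sub>R w)" using assms(2,3) by (simp add: field_simps)
  moreover have "norm (s *\<^sub>R w) - norm x \<le> norm (x - s *\<^sub>R w)"
    by (metis norm_minus_commute norm_triangle_ineq2)
  ultimately show "R < norm (x - s *\<^sub>R w)" by linarith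
qed

lemma line_sum_eq_finite_sum:
  assumes "supported_in_ball R f" "w \<noteq> 0" "(R + norm x) / norm w < real n"
  shows "line_sum w f x = (\<Sum>m\<in>{- int n..<int n}. f (x - of_int m *\<^sub>R w))"
proof -
  have "f (x - of_int m *\<^sub>R w) = 0" if "m \<notin> {- int n..<int n}" for m
  proof (rule vanishes_far_along_line[OF assms(1,2)])
    have "int n \<le> \<bar>m\<bar>" using that by auto
    then have "real n \<le> \<bar>of_int m\<bar>" by linarith
    then show "(R + norm x) / norm w < \<bar>of_int m\<bar>" using assms(3) by linarith
  qed
  then have "line_sum w f x = infsum (\<lambda>m. f (x - of_int m *\<^sub>R w)) {- int n..<int n}"
    unfolding line_sum_def by (intro infsum_cong_neutral) auto
  then show ?thesis by simp
qed

lemma sum_unit_integrals: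
  fixes h :: "real \<Rightarrow> real"
  assumes "continuous_on UNIV h"
  shows "(\<Sum>m\<in>{- int n..<int n}. integral {0..1} (\<lambda>t. h (c + of_int m + t)))
         = integral {c - real n..c + real n} h"
proof (induction n)
  case 0
  then show ?case by simp
next
  case (Suc n)
  have unit: "integral {0..1} (\<lambda>t. h (d + t)) = integral {d..d + 1} h" for d
    using integral_shift[of 0 d 1 h] assms
    by (auto simp: o_def add.commute intro: continuous_on_subset)
  have int: "h integrable_on {a..b}" for a b
    using assms by (intro integrable_continuous_real) (auto intro: continuous_on_subset)
  have "{- int (Suc n)..<int (Suc n)} = insert (- int (Suc n)) (insert (int n) {- int n..<int n})"
    by auto
  then have "(\<Sum>m\<in>{- int (Suc n)..<int (Suc n)}. integral {0..1} (\<lambda>t. h (c + of_int m + t)))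
     = integral {c - real (Suc n)..c - real n} h
       + (integral {c + real n..c + real (Suc n)} h + integral {c - real n..c + real n} h)"
    using Suc.IH unit[of "c - real (Suc n)"] unit[of "c + real n"] by (simp add: algebra_simps)
  also have "integral {c + real n..c + real (Suc n)} h + integral {c - real n..c + real n} h
     = integral {c - real n..c + real (Suc n)} h"
    using Henstock_Kurzweil_Integration.integral_combine[OF _ _ int, of "c - real n" "c + real n" "c + real (Suc n)"] by linarith
  also have "integral {c - real (Suc n)..c - real n} h + integral {c - real n..c + real (Suc n)} h
     = integral {c - real (Suc n)..c + real (Suc n)} h"
    by (rule Henstock_Kurzweil_Integration.integral_combine) (auto intro: int)
  finally show ?case .
qed

text \<open>On a line parallel to \<open>w\<close>, the averages at the points of a progression with step \<open>w\<close> are the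
  integrals over consecutive segments. Together they cover the line once, wherever the
  progression starts.\<close>

lemma flat_along_segment_average_self:
  fixes g :: "'a::real_normed_vector \<Rightarrow> real"
  assumes g: "continuous_on UNIV g" "supported_in_ball R g" and w: "w \<noteq> 0"
  shows "flat_along w (segment_average w g)"
proof -
  have eq: "line_sum w (segment_average w g) (x - \<tau> *\<^sub>R w)
      = integral {- ((R + norm x) / norm w)..(R + norm x) / norm w} (\<lambda>t. g (x - t *\<^sub>R w))"
    (is "_ = integral {- ?r..?r} ?h") for x \<tau>
  proof -
    have h: "continuous_on T ?h" for T using g(1) by (rule continuous_on_segment)
    obtain n where n: "max ((R + norm w + norm (x - \<tau> *\<^sub>R w)) / norm w) (?r + \<bar>\<tau>\<bar>) < real n"
      using reals_Archimedean2 by blast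
    have "line_sum w (segment_average w g) (x - \<tau> *\<^sub>R w)
        = (\<Sum>m\<in>{- int n..<int n}. segment_average w g (x - \<tau> *\<^sub>R w - of_int m *\<^sub>R w))"
      using n by (intro line_sum_eq_finite_sum[OF supported_in_ball_segment_average[OF g(2)] w]) auto
    also have "\<dots> = (\<Sum>m\<in>{- int n..<int n}. integral {0..1} (\<lambda>t. ?h (\<tau> + of_int m + t)))"
      by (simp add: segment_average_def algebra_simps)
    also have "\<dots> = integral {\<tau> - real n..\<tau> + real n} ?h"
      by (rule sum_unit_integrals[OF h])
    also have "\<dots> = integral {- ?r..?r} ?h"
    proof (rule integral_unique, rule has_integral_on_superset)
      show "(?h has_integral integral {- ?r..?r} ?h) {- ?r..?r}"
        by (intro integrable_integral integrable_continuous_real h)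
      show "{- ?r..?r} \<subseteq> {\<tau> - real n..\<tau> + real n}" using n by auto
      show "?h t = 0" if "t \<notin> {- ?r..?r}" for t
        by (rule vanishes_far_along_line[OF g(2) w]) (use that in auto)
    qed
    finally show ?thesis .
  qed
  show ?thesis
    unfolding flat_along_def using eq eq[of _ 0] by simp
qed

text \<open>Averaging commutes with the sum over the multiples of \<open>w\<close>, since only finitely many of them,
  uniformly over the segment, meet the support.\<close>

lemma flat_along_segment_average:
  fixes g :: "'a::real_normed_vector \<Rightarrow> real"
  assumes g: "continuous_on UNIV g" "supported_in_ball R g" and w: "w \<noteq> 0"
    and flat: "flat_along w g"
  shows "flat_along w (segment_average u g)"
proof -
  have eq: "line_sum w (segment_average u g) x = integral {0..1} (\<lambda>t. line_sum w g (x - t *\<^sub>R u))"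
    for x
  proof -
    obtain n where n: "(R + norm u + norm x) / norm w < real n"
      using reals_Archimedean2 by blast
    have fin: "line_sum w g (x - t *\<^sub>R u) = (\<Sum>m\<in>{- int n..<int n}. g (x - t *\<^sub>R u - of_int m *\<^sub>R w))"
      if t: "t \<in> {0..1}" for t
    proof (rule line_sum_eq_finite_sum[OF g(2) w])
      have "norm (t *\<^sub>R u) \<le> norm u" using t by (simp add: mult_left_le_one_le)
      then have "norm (x - t *\<^sub>R u) \<le> norm u + norm x"
        using norm_triangle_ineq4[of x "t *\<^sub>R u"] by linarith
      then have "(R + norm (x - t *\<^sub>R u)) / norm w \<le> (R + norm u + norm x) / norm w"
        by (intro divide_right_mono) auto
      then show "(R + norm (x - t *\<^sub>R u)) / norm w < real n" using n by linarith
    qed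
    have "line_sum w (segment_average u g) x
        = (\<Sum>m\<in>{- int n..<int n}. integral {0..1} (\<lambda>t. g (x - of_int m *\<^sub>R w - t *\<^sub>R u)))"
      using line_sum_eq_finite_sum[OF supported_in_ball_segment_average[OF g(2)] w n]
      by (simp add: segment_average_def)
    also have "\<dots> = integral {0..1} (\<lambda>t. \<Sum>m\<in>{- int n..<int n}. g (x - of_int m *\<^sub>R w - t *\<^sub>R u))"
      by (intro integral_sum[symmetric] integrable_continuous_real continuous_on_segment g) auto
    also have "\<dots> = integral {0..1} (\<lambda>t. line_sum w g (x - t *\<^sub>R u))"
      by (intro integral_cong) (simp add: fin algebra_simps)
    finally show ?thesis .
  qed
  have "line_sum w g (x - \<tau> *\<^sub>R w - t *\<^sub>R u) = line_sum w g (x - t *\<^sub>R u)" for x \<tau> t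
    using flat unfolding flat_along_def
    by (metis diff_diff_add add.commute)
  then show ?thesis unfolding flat_along_def eq by simp
qed

lemma foldr_segment_average:
  fixes g :: "'a::real_normed_vector \<Rightarrow> real"
  assumes g: "continuous_on UNIV g" "supported_in_ball R g" "\<And>x. 0 \<le> g x" "0 < g 0"
    and ws: "0 \<notin> set ws"
  defines "f \<equiv> foldr segment_average ws g"
  shows "continuous_on UNIV f" "supported_in_ball (R + sum_list (map norm ws)) f"
    "\<And>x. 0 \<le> f x" "0 < f 0" "\<forall>w\<in>set ws. flat_along w f"
proof -
  have "continuous_on UNIV f \<and> supported_in_ball (R + sum_list (map norm ws)) f \<and>
    (\<forall>x. 0 \<le> f x) \<and> 0 < f 0 \<and> (\<forall>w\<in>set ws. flat_along w f)"
    using ws unfolding f_def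
  proof (induction ws)
    case Nil
    then show ?case using g by simp
  next
    case (Cons w ws)
    let ?g = "foldr segment_average ws g"
    have IH: "continuous_on UNIV ?g" "supported_in_ball (R + sum_list (map norm ws)) ?g"
      "\<And>x. 0 \<le> ?g x" "0 < ?g 0" "\<And>u. u \<in> set ws \<Longrightarrow> flat_along u ?g"
      and nz: "w \<noteq> 0" "0 \<notin> set ws"
      using Cons by auto
    have "flat_along u (segment_average w ?g)" if "u \<in> set ws" for u
      using that nz(2) by (intro flat_along_segment_average[OF IH(1,2)] IH(5)) auto
    moreover have "supported_in_ball (R + sum_list (map norm (w # ws))) (segment_average w ?g)"
      using supported_in_ball_segment_average[OF IH(2), of w] by (simp add: algebra_simps)
    ultimately show ?case
      using continuous_on_segment_average[OF IH(1)] segment_average_nonneg[of ?g, OF IH(1,3)]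
        segment_average_pos[OF IH(1,3,4)] flat_along_segment_average_self[OF IH(1,2) nz(1)]
      by auto
  qed
  then show "continuous_on UNIV f" "supported_in_ball (R + sum_list (map norm ws)) f"
    "\<And>x. 0 \<le> f x" "0 < f 0" "\<forall>w\<in>set ws. flat_along w f"
    by blast+
qed


section \<open>Tiling with a lattice from flatness in two directions\<close>

definition cross2 :: "real^2 \<Rightarrow> real^2 \<Rightarrow> real" where
  "cross2 p q = p $ 1 * q $ 2 - p $ 2 * q $ 1"

lemma cross2_simps:
  "cross2 (p + p') q = cross2 p q + cross2 p' q" "cross2 p (q + q') = cross2 p q + cross2 p q'"
  "cross2 (p - p') q = cross2 p q - cross2 p' q" "cross2 p (q - q') = cross2 p q - cross2 p q'"
  "cross2 (a *\<^sub>R p) q = a * cross2 p q" "cross2 p (a *\<^sub>R q) = a * cross2 p q"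
  "cross2 p p = 0"
  unfolding cross2_def by (simp_all add: algebra_simps)

lemma abs_cross2_le: "\<bar>cross2 p q\<bar> \<le> 2 * (norm p * norm q)"
proof -
  have "\<bar>p $ i * q $ j\<bar> \<le> norm p * norm q" for i j
    unfolding abs_mult by (intro mult_mono component_le_norm_cart) auto
  from this[of 1 2] this[of 2 1] show ?thesis unfolding cross2_def by linarith
qed

text \<open>Cramer's rule.\<close>

lemma cross2_expansion:
  assumes "cross2 w v \<noteq> 0"
  shows "x = (cross2 x v / cross2 w v) *\<^sub>R w + (cross2 w x / cross2 w v) *\<^sub>R v"
proof -
  have "cross2 w v * x $ i = cross2 x v * w $ i + cross2 w x * v $ i" for i
    using exhaust_2[of i] unfolding cross2_def by (auto simp: algebra_simps)
  then show ?thesis using assms by (simp add: vec_eq_iff field_simps)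
qed

definition lattice_gen :: "real^2 \<Rightarrow> real^2 \<Rightarrow> (real^2) set" where
  "lattice_gen w b = range (\<lambda>(m::int, n::int). of_int m *\<^sub>R w + of_int n *\<^sub>R b)"

lemma zero_in_lattice_gen: "0 \<in> lattice_gen w b"
  unfolding lattice_gen_def by (rule range_eqI[where x = "(0, 0)"]) simp

text \<open>By Cramer's rule the coordinates of a lattice point are bounded in terms of its norm.\<close>

lemma finite_lattice_support:
  assumes "supported_in_ball R f" "cross2 w b \<noteq> 0"
  shows "finite {(m::int, n::int). f (x - (of_int m *\<^sub>R w + of_int n *\<^sub>R b)) \<noteq> 0}"
proof -
  define c where "c = 2 * ((norm x + R) * (norm w + norm b)) / \<bar>cross2 w b\<bar>"
  have "m \<in> {- \<lceil>c\<rceil>..\<lceil>c\<rceil>} \<and> n \<in> {- \<lceil>c\<rceil>..\<lceil>c\<rceil>}"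
    if "f (x - (of_int m *\<^sub>R w + of_int n *\<^sub>R b)) \<noteq> 0" for m n :: int
  proof -
    let ?l = "of_int m *\<^sub>R w + of_int n *\<^sub>R b :: real^2"
    have "norm (x - ?l) \<le> R" using assms(1) that unfolding supported_in_ball_def by blast
    then have l: "norm ?l \<le> norm x + R" using norm_triangle_ineq3[of x ?l] by linarith
    have le: "2 * (norm ?l * t) \<le> 2 * ((norm x + R) * (norm w + norm b))"
      if "t \<in> {norm w, norm b}" for t
      using that l by (intro mult_left_mono mult_mono) (auto intro: order_trans[OF norm_ge_zero])
    have "\<bar>of_int m\<bar> * \<bar>cross2 w b\<bar> = \<bar>cross2 ?l b\<bar>" "\<bar>of_int n\<bar> * \<bar>cross2 w b\<bar> = \<bar>cross2 w ?l\<bar>"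
      unfolding abs_mult[symmetric] by (simp_all add: cross2_simps)
    then have "\<bar>of_int m\<bar> * \<bar>cross2 w b\<bar> \<le> 2 * ((norm x + R) * (norm w + norm b))"
      "\<bar>of_int n\<bar> * \<bar>cross2 w b\<bar> \<le> 2 * ((norm x + R) * (norm w + norm b))"
      using abs_cross2_le[of ?l b] abs_cross2_le[of w ?l] le[of "norm b"] le[of "norm w"]
      by (auto simp: mult.commute)
    then have "\<bar>of_int m\<bar> \<le> c" "\<bar>of_int n\<bar> \<le> c"
      using assms(2) by (simp_all add: c_def pos_le_divide_eq)
    then show ?thesis by (simp add: abs_le_iff) linarith
  qed
  then have "{(m, n). f (x - (of_int m *\<^sub>R w + of_int n *\<^sub>R b)) \<noteq> 0}
      \<subseteq> {- \<lceil>c\<rceil>..\<lceil>c\<rceil>} \<times> {- \<lceil>c\<rceil>..\<lceil>c\<rceil>}"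
    by blast
  then show ?thesis by (rule finite_subset) auto
qed

lemma lattice_summable:
  assumes "supported_in_ball R f" "cross2 w b \<noteq> 0"
  shows "(\<lambda>(m::int, n::int). f (x - (of_int m *\<^sub>R w + of_int n *\<^sub>R b))) summable_on UNIV"
proof -
  let ?F = "{(m::int, n::int). f (x - (of_int m *\<^sub>R w + of_int n *\<^sub>R b)) \<noteq> 0}"
  have "(\<lambda>(m::int, n::int). f (x - (of_int m *\<^sub>R w + of_int n *\<^sub>R b))) summable_on ?F"
    by (rule summable_on_finite[OF finite_lattice_support[OF assms]])
  then show ?thesis
    by (subst (asm) summable_on_cong_neutral[where T = UNIV]) auto
qed

text \<open>The sum over the lattice can be organised in lines parallel to either basis vector; flatness
  along one of them acts on one of the two forms.\<close>

lemma lattice_sum_iterated: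
  assumes "supported_in_ball R f" "cross2 w b \<noteq> 0"
  shows "(\<Sum>\<^sub>\<infinity>(m::int, n::int). f (x - (of_int m *\<^sub>R w + of_int n *\<^sub>R b)))
       = (\<Sum>\<^sub>\<infinity>n::int. line_sum w f (x - of_int n *\<^sub>R b))"
    (is ?one)
    and "(\<Sum>\<^sub>\<infinity>(m::int, n::int). f (x - (of_int m *\<^sub>R w + of_int n *\<^sub>R b)))
       = (\<Sum>\<^sub>\<infinity>m::int. line_sum b f (x - of_int m *\<^sub>R w))"
    (is ?two)
proof -
  have s: "(\<lambda>(m::int, n::int). f (x - (of_int m *\<^sub>R w + of_int n *\<^sub>R b))) summable_on (UNIV \<times> UNIV)"
    using lattice_summable[OF assms] by simp
  show two: ?two
    using infsum_Sigma'_banach[OF s] by (simp add: line_sum_def diff_diff_eq)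
  show ?one
    unfolding two using infsum_swap_banach[OF s]
    by (simp add: line_sum_def diff_diff_eq add.commute)
qed

lemma inj_lattice_coordinates:
  assumes "cross2 w b \<noteq> 0"
  shows "inj (\<lambda>(m::int, n::int). of_int m *\<^sub>R w + of_int n *\<^sub>R b)"
proof (rule injI, clarify)
  fix m n m' n' :: int
  assume eq: "of_int m *\<^sub>R w + of_int n *\<^sub>R b = of_int m' *\<^sub>R w + of_int n' *\<^sub>R b"
  from arg_cong[OF eq, of "\<lambda>l. cross2 l b"] arg_cong[OF eq, of "cross2 w"]
  show "m = m' \<and> n = n'" using assms by (simp add: cross2_simps)
qed

text \<open>Row by row, flatness along \<open>w\<close> removes the slide \<open>\<tau> w\<close>, so the sum over the lattice generated by
  \<open>w\<close> and \<open>b\<close> equals the sum over the lattice generated by \<open>w\<close> and \<open>v\<close>. The latter sum is invariant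
  under all multiples of \<open>w\<close> and, after exchanging the order of summation, of \<open>v\<close>. These span the
  plane.\<close>

lemma lattice_tiling_if_flat:
  assumes f: "supported_in_ball R f" and flat: "flat_along w f" "flat_along v f"
    and wv: "cross2 w v \<noteq> 0" and b: "b = \<sigma> *\<^sub>R v + \<tau> *\<^sub>R w" and \<sigma>: "\<sigma> = 1 \<or> \<sigma> = -1"
  shows "\<exists>c. \<forall>x. ((\<lambda>l. f (x - l)) has_sum c) (lattice_gen w b)"
proof -
  define H where "H x = (\<Sum>\<^sub>\<infinity>n::int. line_sum w f (x - of_int n *\<^sub>R v))" for x
  have wb: "cross2 w b \<noteq> 0" using wv \<sigma> by (auto simp: b cross2_simps)
  have Hw: "H (x - t *\<^sub>R w) = H x" for x t
  proof -
    have "line_sum w f (x - t *\<^sub>R w - of_int n *\<^sub>R v) = line_sum w f (x - of_int n *\<^sub>R v)" for n :: int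
      using flat(1) unfolding flat_along_def by (metis diff_diff_add add.commute)
    then show ?thesis by (simp add: H_def)
  qed
  have Hv: "H (x - t *\<^sub>R v) = H x" for x t
  proof -
    have "line_sum v f (x - t *\<^sub>R v - of_int m *\<^sub>R w) = line_sum v f (x - of_int m *\<^sub>R w)" for m :: int
      using flat(2) unfolding flat_along_def by (metis diff_diff_add add.commute)
    moreover have "H y = (\<Sum>\<^sub>\<infinity>m::int. line_sum v f (y - of_int m *\<^sub>R w))" for y
      using lattice_sum_iterated[OF f wv] by (simp add: H_def)
    ultimately show ?thesis by simp
  qed
  have const: "H x = H 0" for x
  proof -
    have "0 = x - (cross2 x v / cross2 w v) *\<^sub>R w - (cross2 w x / cross2 w v) *\<^sub>R v"
      using cross2_expansion[OF wv, of x] by (simp add: algebra_simps)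
    then show ?thesis using Hw Hv by metis
  qed
  have "((\<lambda>l. f (x - l)) has_sum H 0) (lattice_gen w b)" for x
  proof -
    have shear: "line_sum w f (x - of_int n *\<^sub>R b) = line_sum w f (x - (\<sigma> * of_int n) *\<^sub>R v)" for n :: int
    proof -
      have "x - of_int n *\<^sub>R b = x - (\<sigma> * of_int n) *\<^sub>R v - (of_int n * \<tau>) *\<^sub>R w"
        by (simp add: b algebra_simps)
      then show ?thesis using flat(1) unfolding flat_along_def by metis
    qed
    have "(\<Sum>\<^sub>\<infinity>(m::int, n::int). f (x - (of_int m *\<^sub>R w + of_int n *\<^sub>R b)))
        = (\<Sum>\<^sub>\<infinity>n::int. line_sum w f (x - (\<sigma> * of_int n) *\<^sub>R v))"
      by (simp only: lattice_sum_iterated(1)[OF f wb] shear)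
    also have "\<dots> = H x"
    proof (cases "\<sigma> = 1")
      case False
      then have "\<sigma> = -1" using \<sigma> by simp
      moreover have "bij (uminus :: int \<Rightarrow> int)" by (rule bij_uminus)
      ultimately show ?thesis
        using infsum_reindex_bij_betw[of uminus UNIV UNIV
            "\<lambda>n::int. line_sum w f (x - of_int n *\<^sub>R v)"]
        by (simp add: H_def)
    qed (simp add: H_def)
    finally have "(\<Sum>\<^sub>\<infinity>(m::int, n::int). f (x - (of_int m *\<^sub>R w + of_int n *\<^sub>R b))) = H 0"
      using const by simp
    then have "((\<lambda>(m::int, n::int). f (x - (of_int m *\<^sub>R w + of_int n *\<^sub>R b))) has_sum H 0) UNIV"
      using has_sum_infsum[OF lattice_summable[OF f wb, of x]] by simp
    then show ?thesis
      unfolding lattice_gen_def has_sum_reindex[OF inj_lattice_coordinates[OF wb]]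
      by (simp add: o_def case_prod_unfold)
  qed
  then show ?thesis by blast
qed

text \<open>Equal volumes put \<open>b\<close> into the form \<open>\<plusminus>v + \<tau> w\<close>. The level is positive because the lattice sum at
  the origin contains the positive term \<open>f 0\<close>.\<close>

lemma tiles_with_if_flat:
  assumes f: "supported_in_ball R f" "\<And>x. 0 \<le> f x" "0 < f 0"
    and flat: "flat_along w f" "flat_along v f"
    and wv: "cross2 w v \<noteq> 0" and wb: "\<bar>cross2 w b\<bar> = \<bar>cross2 w v\<bar>"
  shows "tiles_with f (lattice_gen w b)"
proof -
  define \<sigma> where "\<sigma> = cross2 w b / cross2 w v"
  have "b = \<sigma> *\<^sub>R v + (cross2 b v / cross2 w v) *\<^sub>R w"
    unfolding \<sigma>_def using cross2_expansion[OF wv, of b] by (metis add.commute)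
  moreover have "\<sigma> = 1 \<or> \<sigma> = -1"
  proof -
    have "\<bar>\<sigma>\<bar> = 1" using wb wv by (simp add: \<sigma>_def abs_divide)
    then show ?thesis by linarith
  qed
  ultimately obtain c where c: "\<And>x. ((\<lambda>l. f (x - l)) has_sum c) (lattice_gen w b)"
    using lattice_tiling_if_flat[OF f(1) flat wv] by blast
  have "f (0 - 0) \<le> c"
    using has_sum_mono_neutral[OF has_sum_finite[of "{0}" "\<lambda>l. f (0 - l)"] c[of 0]]
      zero_in_lattice_gen[of w b] f(2) by auto
  then have "c \<noteq> 0" using f(3) by simp
  then show ?thesis unfolding tiles_with_def using c by blast
qed

lemma integrable_lebesgue_continuous_supported:
  fixes f :: "real^2 \<Rightarrow> real"
  assumes "continuous_on UNIV f" "supported_in_ball R f"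
  shows "integrable lebesgue f"
proof -
  have "integrable lborel (\<lambda>x. indicator (cball 0 R) x *\<^sub>R f x)"
    using assms(1) by (intro borel_integrable_compact) (auto intro: continuous_on_subset)
  moreover have "(\<lambda>x. indicator (cball 0 R) x *\<^sub>R f x) = f"
    using assms(2) by (auto simp: supported_in_ball_def indicator_def fun_eq_iff)
  ultimately have "integrable lborel f" by simp
  then show ?thesis by (intro integrable_completion[THEN iffD2]) auto
qed

lemma ess_supp_subset_cball:
  assumes "supported_in_ball R f"
  shows "ess_supp f \<subseteq> cball 0 R"
proof -
  have "open (- cball 0 R :: (real^2) set)" by (simp add: open_Compl)
  moreover have "AE x in lebesgue. x \<in> - cball 0 R \<longrightarrow> f x = 0"
    using assms by (intro AE_I2) (auto simp: supported_in_ball_def)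
  ultimately show ?thesis unfolding ess_supp_def by blast
qed

section \<open>Deforming a basis so that the lattice gets a prescribed short vector\<close>

definition columns2 :: "'a^2 \<Rightarrow> 'a^2 \<Rightarrow> 'a^2^2" where
  "columns2 p q = (\<chi> i j. if j = 1 then p $ i else q $ i)"

lemma columns2_nth: "columns2 p q $ i $ 1 = p $ i" "columns2 p q $ i $ 2 = q $ i"
  by (simp_all add: columns2_def)

lemma det_columns2: "det (columns2 p q) = cross2 p q"
  by (simp add: det_2 columns2_nth cross2_def)

lemma columns2_mult: "columns2 p q *v z = z $ 1 *\<^sub>R p + z $ 2 *\<^sub>R q"
  by (simp add: vec_eq_iff matrix_vector_mult_def sum_2 columns2_nth mult.commute)

lemma lattice_of_columns2: "lattice_of (columns2 p q) = lattice_gen p q"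
proof (intro equalityI subsetI)
  fix x assume "x \<in> lattice_of (columns2 p q)"
  then obtain z :: "real^2" where z: "\<And>i. z $ i \<in> \<int>" "x = z $ 1 *\<^sub>R p + z $ 2 *\<^sub>R q"
    unfolding lattice_of_def columns2_mult by blast
  obtain m n where "z $ 1 = of_int m" "z $ 2 = of_int n"
    using z(1) by (meson Ints_cases)
  then show "x \<in> lattice_gen p q"
    unfolding lattice_gen_def z(2) by (intro range_eqI[where x = "(m, n)"]) simp
next
  fix x assume "x \<in> lattice_gen p q"
  then obtain m n :: int where x: "x = of_int m *\<^sub>R p + of_int n *\<^sub>R q"
    unfolding lattice_gen_def by auto
  show "x \<in> lattice_of (columns2 p q)"
    unfolding lattice_of_def columns2_mult mem_Collect_eq
    by (rule exI[where x = "vector [of_int m, of_int n]"]) (simp add: x forall_2)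
qed

lemma lattice_gen_add_multiple: "lattice_gen (w + of_int k *\<^sub>R b) b = lattice_gen w b"
proof -
  have "lattice_gen (w + of_int k *\<^sub>R b) b \<subseteq> lattice_gen w b" for w :: "real^2" and k
    unfolding lattice_gen_def
  proof clarify
    fix m n :: int
    show "of_int m *\<^sub>R (w + of_int k *\<^sub>R b) + of_int n *\<^sub>R b
      \<in> range (\<lambda>(m::int, n::int). of_int m *\<^sub>R w + of_int n *\<^sub>R b)"
      by (rule range_eqI[where x = "(m, m * k + n)"]) (simp add: algebra_simps)
  qed
  from this[of w k] this[of "w + of_int k *\<^sub>R b" "-k"] show ?thesis by simp
qed

lemma avoid_countable:
  fixes \<delta> :: real
  assumes "countable X" "0 < \<delta>"
  obtains r where "0 < r" "r < \<delta>" "r \<notin> X"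
proof -
  have "\<not> {0<..<\<delta>} \<subseteq> X"
    using assms countable_subset uncountable_open_interval[of 0 \<delta>] by auto
  then obtain r where "r \<in> {0<..<\<delta>}" "r \<notin> X" by blast
  then show ?thesis using that[of r] by simp
qed

text \<open>Lattice points come within bounded distance of every point \<open>(t, 0)\<close>, so for large \<open>t\<close> some lattice
  vector is nearly horizontal. Dividing by the gcd of its coordinates keeps the direction and makes it
  primitive; \<open>(r, s)\<close> completes it to a basis.\<close>

lemma nearly_horizontal_primitive_vector:
  fixes A :: "real^2^2"
  assumes "invertible A"
  obtains p q r s :: int where "p * s - q * r = 1"
    "\<bar>A $ 2 $ 1 * of_int p + A $ 2 $ 2 * of_int q\<bar> < \<bar>A $ 1 $ 1 * of_int p + A $ 1 $ 2 * of_int q\<bar>"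
proof -
  define D where "D = det A"
  have D: "D \<noteq> 0" using assms by (simp add: D_def invertible_det_nz)
  \<comment> \<open>\<open>(z1, z2)\<close> solves \<open>A z = (1, 0)\<close>, and \<open>t z\<close> is rounded down to the integer point \<open>(P, Q)\<close>.\<close>
  define t where "t = \<bar>A $ 1 $ 1\<bar> + \<bar>A $ 1 $ 2\<bar> + \<bar>A $ 2 $ 1\<bar> + \<bar>A $ 2 $ 2\<bar> + 1"
  define z1 z2 where "z1 = A $ 2 $ 2 / D" and "z2 = - A $ 2 $ 1 / D"
  have z: "A $ 1 $ 1 * z1 + A $ 1 $ 2 * z2 = 1" "A $ 2 $ 1 * z1 + A $ 2 $ 2 * z2 = 0"
  proof -
    have "A $ 1 $ 1 * A $ 2 $ 2 - A $ 1 $ 2 * A $ 2 $ 1 = D" by (simp add: D_def det_2)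
    moreover have "A $ 1 $ 1 * z1 + A $ 1 $ 2 * z2 = (A $ 1 $ 1 * A $ 2 $ 2 - A $ 1 $ 2 * A $ 2 $ 1) / D"
      by (simp add: z1_def z2_def diff_divide_distrib)
    ultimately show "A $ 1 $ 1 * z1 + A $ 1 $ 2 * z2 = 1" using D by simp
  qed (simp add: z1_def z2_def)
  define P Q where "P = \<lfloor>t * z1\<rfloor>" and "Q = \<lfloor>t * z2\<rfloor>"
  define e1 e2 where "e1 = t * z1 - of_int P" and "e2 = t * z2 - of_int Q"
  have e: "\<bar>e1\<bar> \<le> 1" "\<bar>e2\<bar> \<le> 1" unfolding e1_def e2_def P_def Q_def by linarith+
  have rounding: "\<bar>x * e1 + y * e2\<bar> \<le> \<bar>x\<bar> + \<bar>y\<bar>" for x y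
  proof -
    have "\<bar>x * e1\<bar> \<le> \<bar>x\<bar>" "\<bar>y * e2\<bar> \<le> \<bar>y\<bar>"
      using e by (simp_all add: abs_mult mult_left_le)
    then show ?thesis by linarith
  qed
  have "A $ 1 $ 1 * of_int P + A $ 1 $ 2 * of_int Q
      = t * (A $ 1 $ 1 * z1 + A $ 1 $ 2 * z2) - (A $ 1 $ 1 * e1 + A $ 1 $ 2 * e2)"
    "A $ 2 $ 1 * of_int P + A $ 2 $ 2 * of_int Q
      = t * (A $ 2 $ 1 * z1 + A $ 2 $ 2 * z2) - (A $ 2 $ 1 * e1 + A $ 2 $ 2 * e2)"
    by (simp_all add: e1_def e2_def algebra_simps)
  note PQ_eqs = this[unfolded z mult_1_right mult_zero_right diff_0]
  have dominates: "\<bar>Y\<bar> < \<bar>X\<bar>"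
    if "X = t - e" "Y = - e'" "\<bar>e\<bar> \<le> x" "\<bar>e'\<bar> \<le> y" "x + y < t" for X Y e e' x y :: real
    using that by linarith
  have PQ: "\<bar>A $ 2 $ 1 * of_int P + A $ 2 $ 2 * of_int Q\<bar> < \<bar>A $ 1 $ 1 * of_int P + A $ 1 $ 2 * of_int Q\<bar>"
    by (rule dominates[OF PQ_eqs rounding rounding]) (simp add: t_def)
  then have "P \<noteq> 0 \<or> Q \<noteq> 0" by auto
  then have g: "gcd P Q > 0" by simp
  define p q where "p = P div gcd P Q" and "q = Q div gcd P Q"
  have pq: "P = gcd P Q * p" "Q = gcd P Q * q" by (simp_all add: p_def q_def)
  have "gcd p q = 1"
    using \<open>P \<noteq> 0 \<or> Q \<noteq> 0\<close> div_gcd_coprime[of P Q] by (simp add: p_def q_def)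
  then obtain s r where "s * p + r * q = 1" using bezout_int[of p q] by auto
  then have "p * s - q * (- r) = 1" by (simp add: mult.commute)
  moreover
  have scale: "x * of_int P + y * of_int Q = of_int (gcd P Q) * (x * of_int p + y * of_int q)" for x y :: real
  proof -
    have "of_int P = (of_int (gcd P Q) * of_int p :: real)" "of_int Q = (of_int (gcd P Q) * of_int q :: real)"
      using pq by (metis of_int_mult)+
    then show ?thesis by (simp only: distrib_left mult_ac)
  qed
  have "\<bar>A $ 2 $ 1 * of_int p + A $ 2 $ 2 * of_int q\<bar> < \<bar>A $ 1 $ 1 * of_int p + A $ 1 $ 2 * of_int q\<bar>"
    using PQ g unfolding scale abs_mult by (simp add: mult_less_cancel_left)
  ultimately show ?thesis by (rule that)
qed

text \<open>With a basis \<open>u, c\<close> of the lattice of \<open>A\<close>, take \<open>A C\<close> to have the columns \<open>k c\<^sub>2 + u\<close> and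
  \<open>c\<^sub>2 = c + m u\<close>. Replacing \<open>c\<^sub>2\<close> by \<open>c\<^sub>2 + (u - w) / k\<close> and keeping the first column replaces \<open>u\<close> by
  \<open>w\<close>. Since \<open>w \<times> w = 0\<close>, the determinant is kept exactly when \<open>w \<times> d = det A\<close> for
  \<open>d = c + (m + 1/k) u\<close>. With the first coordinate of \<open>w\<close> prescribed, this determines the
  second one, which is small because \<open>d\<close> has nearly the direction of \<open>u\<close>, hence slope below 1.
  A further small multiple of \<open>w\<close> added to the second column does not affect the determinant, and
  makes the quotient of the first coordinates irrational, so that the lattice has no vertical vector.\<close>

lemma approximate_by_narrow_basis:
  fixes A :: "real^2^2"
  assumes A: "invertible A" and \<eta>: "0 < \<eta>" and \<epsilon>: "0 < \<epsilon>"
  obtains B :: "real^2^2" and C :: "int^2^2" and w b :: "real^2" where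
    "det C = 1" "det B = det A"
    "\<And>i j. \<bar>(B - A ** map_matrix real_of_int C) $ i $ j\<bar> \<le> \<epsilon>"
    "lattice_of B = lattice_gen w b" "cross2 w b = det A"
    "w $ 1 = \<bar>det A\<bar> * \<eta>" "\<bar>w $ 2\<bar> \<le> \<bar>det A\<bar> * \<eta>" "b $ 1 / w $ 1 \<notin> \<rat>"
proof -
  define D where "D = det A"
  have D: "D \<noteq> 0" using A by (simp add: D_def invertible_det_nz)
  define a where "a = \<bar>D\<bar> * \<eta>"
  have a: "0 < a" using D \<eta> by (simp add: a_def)
  obtain p q r s :: int where pqrs: "p * s - q * r = 1"
    and slope: "\<bar>A $ 2 $ 1 * of_int p + A $ 2 $ 2 * of_int q\<bar> < \<bar>A $ 1 $ 1 * of_int p + A $ 1 $ 2 * of_int q\<bar>"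
    using nearly_horizontal_primitive_vector[OF A] .
  define u c where "u = (\<chi> i. A $ i $ 1 * of_int p + A $ i $ 2 * of_int q)"
    and "c = (\<chi> i. A $ i $ 1 * of_int r + A $ i $ 2 * of_int s)"
  have uc: "cross2 u c = D"
  proof -
    have "cross2 u c = D * of_int (p * s - q * r)"
      by (simp add: cross2_def u_def c_def D_def det_2 algebra_simps)
    then show ?thesis using pqrs by simp
  qed
  have u: "\<bar>u $ 2\<bar> < \<bar>u $ 1\<bar>" using slope by (simp add: u_def)
  \<comment> \<open>A large \<open>m\<close> turns \<open>d\<close> towards \<open>u\<close>, which bounds the second coordinate of \<open>w\<close> by \<open>a\<close>, uniformly in \<open>k\<close>.\<close>
  obtain m :: nat where "(\<bar>D\<bar> + a * (\<bar>c $ 1\<bar> + \<bar>c $ 2\<bar>)) / (a * (\<bar>u $ 1\<bar> - \<bar>u $ 2\<bar>)) < real m"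
    using reals_Archimedean2 by blast
  then have m: "\<bar>D\<bar> + a * (\<bar>c $ 1\<bar> + \<bar>c $ 2\<bar>) < real m * (a * (\<bar>u $ 1\<bar> - \<bar>u $ 2\<bar>))"
    using a u by (subst (asm) pos_divide_less_eq) auto
  \<comment> \<open>A large \<open>k\<close> makes the change \<open>(u - w) / k\<close> of the second column small.\<close>
  obtain k :: nat where "(\<bar>u $ 1\<bar> + \<bar>u $ 2\<bar> + a) / (\<epsilon> / 2) < real k"
    using reals_Archimedean2 by blast
  then have k: "\<bar>u $ 1\<bar> + \<bar>u $ 2\<bar> + a < real k * (\<epsilon> / 2)"
    using \<epsilon> by (subst (asm) pos_divide_less_eq) auto
  have k0: "0 < k" using k a by (cases "k = 0") auto
  define d where "d = c + (real m + 1 / real k) *\<^sub>R u"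
  have d: "a * \<bar>d $ 2\<bar> + \<bar>D\<bar> \<le> a * \<bar>d $ 1\<bar>"
  proof -
    define \<mu> where "\<mu> = real m + 1 / real k"
    have \<mu>: "real m \<le> \<mu>" by (simp add: \<mu>_def)
    have "0 \<le> a * (\<bar>u $ 1\<bar> - \<bar>u $ 2\<bar>)" using a u by simp
    from m mult_right_mono[OF \<mu> this]
    have "\<bar>D\<bar> + a * (\<bar>c $ 1\<bar> + \<bar>c $ 2\<bar>) \<le> \<mu> * (a * (\<bar>u $ 1\<bar> - \<bar>u $ 2\<bar>))"
      by linarith
    moreover have "a * \<bar>d $ 2\<bar> \<le> a * (\<bar>c $ 2\<bar> + \<mu> * \<bar>u $ 2\<bar>)"
      using a \<mu> abs_triangle_ineq[of "c $ 2" "\<mu> * u $ 2"]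
      by (intro mult_left_mono) (auto simp: d_def \<mu>_def[symmetric] abs_mult)
    moreover have "a * (\<mu> * \<bar>u $ 1\<bar> - \<bar>c $ 1\<bar>) \<le> a * \<bar>d $ 1\<bar>"
      using a \<mu> abs_triangle_ineq2[of "\<mu> * u $ 1" "- c $ 1"]
      by (intro mult_left_mono) (auto simp: d_def \<mu>_def[symmetric] abs_mult add.commute)
    ultimately show ?thesis by (simp add: algebra_simps)
  qed
  have d1: "d $ 1 \<noteq> 0"
  proof
    assume "d $ 1 = 0"
    moreover have "0 \<le> a * \<bar>d $ 2\<bar>" using a by simp
    ultimately show False using d D by simp
  qed
  define y where "y = (a * d $ 2 - D) / d $ 1"
  have y: "\<bar>y\<bar> \<le> a"
  proof -
    have "\<bar>a * d $ 2 - D\<bar> \<le> a * \<bar>d $ 1\<bar>"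
      using d a abs_triangle_ineq4[of "a * d $ 2" D] by (simp add: abs_mult)
    then show ?thesis using d1 by (simp add: y_def pos_divide_le_eq)
  qed
  define w where "w = (vector [a, y] :: real^2)"
  have w: "w $ 1 = a" "w $ 2 = y" by (simp_all add: w_def)
  have wd: "cross2 w d = D" using d1 by (simp add: cross2_def w y_def)
  define c2 where "c2 = c + real m *\<^sub>R u"
  define b0 where "b0 = c2 + (1 / real k) *\<^sub>R (u - w)"
  \<comment> \<open>The multiple \<open>\<rho> w\<close> enters the first column with the factor \<open>k\<close>, hence the bound on \<open>\<rho>\<close>.\<close>
  have "countable ((\<lambda>x. x - b0 $ 1 / a) ` \<rat>)" by (intro countable_image countable_rat)
  moreover have "0 < \<epsilon> / (2 * real k * a)" using \<epsilon> a k0 by simp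
  ultimately obtain \<rho>
    where \<rho>: "0 < \<rho>" "\<rho> < \<epsilon> / (2 * real k * a)" "\<rho> \<notin> (\<lambda>x. x - b0 $ 1 / a) ` \<rat>"
    by (rule avoid_countable)
  define b where "b = b0 + \<rho> *\<^sub>R w"
  have wb: "cross2 w b = D"
    using wd by (simp add: b_def b0_def c2_def d_def cross2_simps algebra_simps)
  have irr: "b $ 1 / w $ 1 \<notin> \<rat>"
  proof
    assume "b $ 1 / w $ 1 \<in> \<rat>"
    moreover have "\<rho> = b $ 1 / w $ 1 - b0 $ 1 / a" using a by (simp add: b_def w field_simps)
    ultimately show False using \<rho>(3) by blast
  qed
  define B where "B = columns2 (w + real k *\<^sub>R b) b"
  define C :: "int^2^2" where "C = columns2 (vector [int k * (r + int m * p) + p, int k * (s + int m * q) + q])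
      (vector [r + int m * p, s + int m * q])"
  have detC: "det C = 1"
  proof -
    have "det C = p * s - q * r"
      by (simp add: C_def det_2 columns2_nth algebra_simps)
    then show ?thesis using pqrs by simp
  qed
  have detB: "det B = D" using wb by (simp add: B_def det_columns2 cross2_simps)
  have AC: "A ** map_matrix real_of_int C = columns2 (real k *\<^sub>R c2 + u) c2"
    by (simp add: vec_eq_iff forall_2 matrix_matrix_mult_def sum_2 columns2_nth C_def c2_def u_def c_def
        map_matrix_def algebra_simps)
  have close: "\<bar>(B - A ** map_matrix real_of_int C) $ i $ j\<bar> \<le> \<epsilon>" for i j
  proof -
    have wi: "\<bar>w $ i\<bar> \<le> a" using exhaust_2[of i] w y a by auto
    have ui: "\<bar>u $ i\<bar> \<le> \<bar>u $ 1\<bar> + \<bar>u $ 2\<bar>" using exhaust_2[of i] by auto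
    have half: "real k * \<rho> * \<bar>w $ i\<bar> \<le> \<epsilon> / 2"
    proof -
      have "real k * \<rho> * \<bar>w $ i\<bar> \<le> real k * \<rho> * a"
        using wi \<rho>(1) by (intro mult_left_mono) auto
      also have "\<dots> \<le> \<epsilon> / 2" using \<rho>(2) k0 a by (simp add: field_simps)
      finally show ?thesis .
    qed
    show ?thesis
    proof (cases "j = 1")
      case True
      have "(B - A ** map_matrix real_of_int C) $ i $ 1 = real k * \<rho> * w $ i"
        using k0 by (simp add: AC B_def columns2_nth b_def b0_def field_simps)
      then show ?thesis using True half \<rho>(1) \<epsilon> by (simp add: abs_mult)
    next
      case False
      then have j: "j = 2" using exhaust_2[of j] by auto
      have "(B - A ** map_matrix real_of_int C) $ i $ 2 = (u $ i - w $ i) / real k + \<rho> * w $ i"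
        by (simp add: AC B_def columns2_nth b_def b0_def)
      moreover have "\<bar>(u $ i - w $ i) / real k\<bar> \<le> \<epsilon> / 2"
      proof -
        have "\<bar>u $ i - w $ i\<bar> \<le> real k * (\<epsilon> / 2)" using wi ui k by linarith
        then show ?thesis using k0 by (simp add: field_simps)
      qed
      moreover have "\<bar>\<rho> * w $ i\<bar> \<le> \<epsilon> / 2"
      proof -
        have "1 * (\<rho> * \<bar>w $ i\<bar>) \<le> real k * (\<rho> * \<bar>w $ i\<bar>)"
          using k0 \<rho>(1) by (intro mult_right_mono) auto
        then have "\<rho> * \<bar>w $ i\<bar> \<le> \<epsilon> / 2" using half by (simp only: mult_1_left mult.assoc)
        then show ?thesis using \<rho>(1) by (simp add: abs_mult)
      qed
      ultimately show ?thesis unfolding j by linarith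
    qed
  qed
  have "lattice_of B = lattice_gen w b"
    using lattice_gen_add_multiple[of w "int k" b] by (simp add: B_def lattice_of_columns2)
  with detC detB close wb w y irr that show ?thesis unfolding D_def a_def by blast
qed

section \<open>Generic shears separate lattices\<close>

definition shear :: "real \<Rightarrow> real^2^2" where
  "shear s = columns2 (vector [1, s]) (vector [0, 1])"

lemma shear_nth: "(shear s *v x) $ 1 = x $ 1" "(shear s *v x) $ 2 = x $ 2 + s * x $ 1"
  by (simp_all add: shear_def columns2_mult mult.commute)

lemma shear_mult_nth:
  "(shear s ** B) $ 1 $ j = B $ 1 $ j" "(shear s ** B) $ 2 $ j = B $ 2 $ j + s * B $ 1 $ j"
  by (simp_all add: shear_def matrix_matrix_mult_def sum_2 columns2_nth)

lemma det_shear [simp]: "det (shear s) = 1"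
  by (simp add: shear_def det_columns2 cross2_def)

lemma cross2_shear: "cross2 (shear s *v w) (shear s *v b) = cross2 w b"
  by (simp add: cross2_def shear_nth algebra_simps)

lemma lattice_of_mult: "lattice_of (T ** B) = (*v) T ` lattice_of B"
  unfolding lattice_of_def by (auto simp: matrix_vector_mul_assoc[symmetric])

lemma lattice_gen_image: "(*v) T ` lattice_gen w b = lattice_gen (T *v w) (T *v b)"
  unfolding lattice_gen_def
  by (simp add: image_image case_prod_unfold matrix_vector_right_distrib matrix_vector_mult_scaleR)

lemma countable_lattice_gen: "countable (lattice_gen w b)"
  unfolding lattice_gen_def by simp

lemma no_vertical_lattice_vector:
  assumes "b $ 1 / w $ 1 \<notin> \<rat>" "l \<in> lattice_gen w b" "l $ 1 = 0"
  shows "l = 0"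
proof -
  obtain m n :: int where l: "l = of_int m *\<^sub>R w + of_int n *\<^sub>R b"
    using assms(2) unfolding lattice_gen_def by auto
  have w1: "w $ 1 \<noteq> 0" using assms(1) by auto
  have eq: "of_int m * w $ 1 + of_int n * b $ 1 = 0" using assms(3) by (simp add: l)
  have "n = 0"
  proof (rule ccontr)
    assume "n \<noteq> 0"
    then have "b $ 1 / w $ 1 = - of_int m / of_int n" using eq w1 by (simp add: field_simps)
    then show False using assms(1) by simp
  qed
  then show ?thesis using eq w1 by (simp add: l)
qed

text \<open>Shears keep first coordinates. So if two points \<open>l\<close> and \<open>l'\<close> with nonzero first coordinate are
  sheared by different multiples of \<open>s\<close>, they meet for at most one value of \<open>s\<close>; altogether only
  countably many values are bad.\<close>

lemma generic_shears:
  fixes \<Lambda> :: "nat \<Rightarrow> (real^2) set"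
  assumes count: "\<And>i. i \<in> I \<Longrightarrow> countable (\<Lambda> i)"
    and vert: "\<And>i l. i \<in> I \<Longrightarrow> l \<in> \<Lambda> i \<Longrightarrow> l $ 1 = 0 \<Longrightarrow> l = 0"
    and "0 < \<delta>"
  obtains s where "0 < s" "s < \<delta>"
    "\<forall>i\<in>I. \<forall>j\<in>I. i \<noteq> j \<longrightarrow>
       (*v) (shear (real i * s)) ` \<Lambda> i \<inter> (*v) (shear (real j * s)) ` \<Lambda> j \<subseteq> {0}"
proof -
  define X where "X = (\<Union>i\<in>I. \<Union>j\<in>I. \<Union>l\<in>\<Lambda> i. \<Union>l'\<in>\<Lambda> j.
      {(l' $ 2 - l $ 2) / ((real i - real j) * l $ 1)})"
  have "countable X" unfolding X_def using count by (intro countable_UN) auto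
  then obtain s where s: "0 < s" "s < \<delta>" "s \<notin> X" using avoid_countable[OF _ \<open>0 < \<delta>\<close>] by blast
  have "shear (real i * s) *v l = 0"
    if ij: "i \<in> I" "j \<in> I" "i \<noteq> j" and l: "l \<in> \<Lambda> i" "l' \<in> \<Lambda> j"
      and eq: "shear (real i * s) *v l = shear (real j * s) *v l'" for i j l l'
  proof -
    have x: "l $ 1 = l' $ 1" using arg_cong[OF eq, of "\<lambda>x. x $ 1"] by (simp add: shear_nth)
    have "l $ 2 + real i * s * l $ 1 = l' $ 2 + real j * s * l $ 1"
      using arg_cong[OF eq, of "\<lambda>x. x $ 2"] by (simp add: shear_nth x)
    then have y: "s * ((real i - real j) * l $ 1) = l' $ 2 - l $ 2" by (simp add: algebra_simps)
    have "l $ 1 = 0"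
    proof (rule ccontr)
      assume "l $ 1 \<noteq> 0"
      then have "s = (l' $ 2 - l $ 2) / ((real i - real j) * l $ 1)"
        using y ij(3) by (simp add: eq_divide_eq)
      then show False using s(3) ij l unfolding X_def by blast
    qed
    then have "l = 0" using vert ij(1) l(1) by blast
    then show ?thesis by simp
  qed
  then have "\<forall>i\<in>I. \<forall>j\<in>I. i \<noteq> j \<longrightarrow>
      (*v) (shear (real i * s)) ` \<Lambda> i \<inter> (*v) (shear (real j * s)) ` \<Lambda> j \<subseteq> {0}"
    by blast
  with s(1,2) show ?thesis by (rule that)
qed

section \<open>Many lattices in narrow position and the common tile\<close>

lemma entry_norm_le:
  assumes "\<And>i j. \<bar>M $ i $ j\<bar> \<le> \<epsilon>"
  shows "entry_norm M \<le> \<epsilon>"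
proof -
  have "{\<bar>M $ i $ j\<bar> |i j. True} = (\<lambda>(i, j). \<bar>M $ i $ j\<bar>) ` UNIV" by auto
  then show ?thesis
    unfolding entry_norm_def using assms by (subst Max_le_iff) auto
qed

text \<open>The shears change the second coordinate of \<open>w i\<close> by at most its first coordinate, whence the
  factor 2.\<close>

lemma disjoint_narrow_lattices:
  fixes A :: "nat \<Rightarrow> real^2^2"
  assumes A: "\<And>i. i \<in> {1..N} \<Longrightarrow> invertible (A i)" and \<eta>: "0 < \<eta>" and \<epsilon>: "0 < \<epsilon>"
  obtains B :: "nat \<Rightarrow> real^2^2" and C :: "nat \<Rightarrow> int^2^2" and w b :: "nat \<Rightarrow> real^2" where
    "\<forall>i\<in>{1..N}. det (C i) = 1 \<and> det (B i) = det (A i) \<and>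
       entry_norm (B i - A i ** map_matrix real_of_int (C i)) \<le> \<epsilon> \<and>
       lattice_of (B i) = lattice_gen (w i) (b i) \<and> cross2 (w i) (b i) = det (A i) \<and>
       w i $ 1 = \<bar>det (A i)\<bar> * \<eta> \<and> \<bar>w i $ 2\<bar> \<le> 2 * (\<bar>det (A i)\<bar> * \<eta>)"
    "\<forall>i\<in>{1..N}. \<forall>j\<in>{1..N}. i \<noteq> j \<longrightarrow> lattice_of (B i) \<inter> lattice_of (B j) = {0}"
proof -
  define P :: "nat \<Rightarrow> real^2^2 \<Rightarrow> int^2^2 \<Rightarrow> real^2 \<Rightarrow> real^2 \<Rightarrow> bool" where
    "P i B C w b \<longleftrightarrow> det C = 1 \<and> det B = det (A i) \<and>
      (\<forall>j k. \<bar>(B - A i ** map_matrix real_of_int C) $ j $ k\<bar> \<le> \<epsilon> / 2) \<and>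
      lattice_of B = lattice_gen w b \<and> cross2 w b = det (A i) \<and>
      w $ 1 = \<bar>det (A i)\<bar> * \<eta> \<and> \<bar>w $ 2\<bar> \<le> \<bar>det (A i)\<bar> * \<eta> \<and> b $ 1 / w $ 1 \<notin> \<rat>"
    for i B C w b
  have "\<exists>B C w b. P i B C w b" if "i \<in> {1..N}" for i
    using A[OF that] \<eta> half_gt_zero[OF \<epsilon>] unfolding P_def
    by (rule approximate_by_narrow_basis) blast
  then obtain B C w b where P: "\<And>i. i \<in> {1..N} \<Longrightarrow> P i (B i) (C i) (w i) (b i)"
    by metis
  then have BC: "\<And>i. i \<in> {1..N} \<Longrightarrow> det (C i) = 1" "\<And>i. i \<in> {1..N} \<Longrightarrow> det (B i) = det (A i)"
      "\<And>i j k. i \<in> {1..N} \<Longrightarrow> \<bar>(B i - A i ** map_matrix real_of_int (C i)) $ j $ k\<bar> \<le> \<epsilon> / 2"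
    and lat: "\<And>i. i \<in> {1..N} \<Longrightarrow> lattice_of (B i) = lattice_gen (w i) (b i)"
    and wb: "\<And>i. i \<in> {1..N} \<Longrightarrow> cross2 (w i) (b i) = det (A i)"
    and w: "\<And>i. i \<in> {1..N} \<Longrightarrow> w i $ 1 = \<bar>det (A i)\<bar> * \<eta>"
      "\<And>i. i \<in> {1..N} \<Longrightarrow> \<bar>w i $ 2\<bar> \<le> \<bar>det (A i)\<bar> * \<eta>"
    and irr: "\<And>i. i \<in> {1..N} \<Longrightarrow> b i $ 1 / w i $ 1 \<notin> \<rat>"
    unfolding P_def by blast+
  \<comment> \<open>A shear by \<open>i s\<close> changes an entry by \<open>i s\<close> times an entry of the first row; \<open>E\<close> bounds the latter.\<close>
  define E where "E = 1 + (\<Sum>i\<in>{1..N}. \<bar>B i $ 1 $ 1\<bar> + \<bar>B i $ 1 $ 2\<bar>)"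
  have E: "\<bar>B i $ 1 $ k\<bar> \<le> E" if "i \<in> {1..N}" for i k
  proof -
    have "\<bar>B i $ 1 $ 1\<bar> + \<bar>B i $ 1 $ 2\<bar> \<le> (\<Sum>i\<in>{1..N}. \<bar>B i $ 1 $ 1\<bar> + \<bar>B i $ 1 $ 2\<bar>)"
      using that by (intro member_le_sum) auto
    then show ?thesis using exhaust_2[of k] unfolding E_def by auto
  qed
  have E1: "1 \<le> E" unfolding E_def by (simp add: sum_nonneg)
  define \<delta> where "\<delta> = min 1 (\<epsilon> / 2) / ((real N + 1) * E)"
  have \<delta>: "0 < \<delta>" using \<epsilon> E1 by (simp add: \<delta>_def)
  obtain s where s: "0 < s" "s < \<delta>"
    and disj: "\<forall>i\<in>{1..N}. \<forall>j\<in>{1..N}. i \<noteq> j \<longrightarrow>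
       (*v) (shear (real i * s)) ` lattice_gen (w i) (b i)
         \<inter> (*v) (shear (real j * s)) ` lattice_gen (w j) (b j) \<subseteq> {0}"
    by (rule generic_shears[of "{1..N}" "\<lambda>i. lattice_gen (w i) (b i)" \<delta>,
          OF countable_lattice_gen no_vertical_lattice_vector[OF irr] \<delta>])
  define T where "T i = shear (real i * s)" for i
  have small: "real i * s * E \<le> min 1 (\<epsilon> / 2)" if "i \<in> {1..N}" for i
  proof -
    have "real i * s * E \<le> (real N + 1) * \<delta> * E"
      using that s E1 by (intro mult_right_mono mult_mono) auto
    also have "\<dots> = min 1 (\<epsilon> / 2)" using E1 by (simp add: \<delta>_def)
    finally show ?thesis .
  qed
  have lat': "lattice_of (T i ** B i) = lattice_gen (T i *v w i) (T i *v b i)" if "i \<in> {1..N}" for i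
    by (simp add: lattice_of_mult lat[OF that] lattice_gen_image)
  show ?thesis
  proof (rule that[of C "\<lambda>i. T i ** B i" "\<lambda>i. T i *v w i" "\<lambda>i. T i *v b i"], intro ballI)
    fix i assume i: "i \<in> {1..N}"
    have "\<bar>(T i ** B i - A i ** map_matrix real_of_int (C i)) $ j $ k\<bar> \<le> \<epsilon>" for j k
    proof -
      have "\<bar>real i * s * B i $ 1 $ k\<bar> \<le> real i * s * E"
        using E[OF i] s(1) by (simp add: abs_mult mult_left_mono)
      then have "\<bar>real i * s * B i $ 1 $ k\<bar> \<le> \<epsilon> / 2" using small[OF i] by simp
      moreover have "(T i ** B i) $ j $ k = B i $ j $ k + (if j = 1 then 0 else real i * s * B i $ 1 $ k)"
        using exhaust_2[of j] by (auto simp: T_def shear_mult_nth)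
      ultimately show ?thesis
        using BC(3)[OF i, of j k] \<epsilon> unfolding vector_minus_component by (smt (verit) field_sum_of_halves)
    qed
    moreover have "\<bar>(T i *v w i) $ 2\<bar> \<le> 2 * (\<bar>det (A i)\<bar> * \<eta>)"
    proof -
      have "real i * s \<le> real i * s * E"
        using mult_left_mono[OF E1, of "real i * s"] s(1) by simp
      then have "real i * s \<le> 1" using small[OF i] by simp
      then have "real i * s * w i $ 1 \<le> w i $ 1" using w(1)[OF i] \<eta> by (intro mult_left_le_one_le) (use s in auto)
      moreover have "0 \<le> real i * s * w i $ 1" using w(1)[OF i] \<eta> s by simp
      ultimately show ?thesis using w[OF i] by (auto simp: T_def shear_nth)
    qed
    ultimately show "det (C i) = 1 \<and> det (T i ** B i) = det (A i) \<and>
       entry_norm (T i ** B i - A i ** map_matrix real_of_int (C i)) \<le> \<epsilon> \<and>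
       lattice_of (T i ** B i) = lattice_gen (T i *v w i) (T i *v b i) \<and>
       cross2 (T i *v w i) (T i *v b i) = det (A i) \<and>
       (T i *v w i) $ 1 = \<bar>det (A i)\<bar> * \<eta> \<and> \<bar>(T i *v w i) $ 2\<bar> \<le> 2 * (\<bar>det (A i)\<bar> * \<eta>)"
      using BC(1,2)[OF i] wb[OF i] w(1)[OF i] lat'[OF i]
      by (simp add: entry_norm_le det_mul T_def cross2_shear shear_nth)
  next
    show "\<forall>i\<in>{1..N}. \<forall>j\<in>{1..N}. i \<noteq> j \<longrightarrow>
      lattice_of (T i ** B i) \<inter> lattice_of (T j ** B j) = {0}"
    proof (intro ballI impI)
      fix i j assume ij: "i \<in> {1..N}" "j \<in> {1..N}" "i \<noteq> j"
      have "lattice_of (T i ** B i) \<inter> lattice_of (T j ** B j) \<subseteq> {0}"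
        using disj ij by (simp add: T_def lattice_of_mult lat)
      moreover have "0 \<in> lattice_of (T i ** B i) \<inter> lattice_of (T j ** B j)"
        using ij by (simp add: lat' zero_in_lattice_gen)
      ultimately show "lattice_of (T i ** B i) \<inter> lattice_of (T j ** B j) = {0}" by blast
    qed
  qed
qed

text \<open>Averaging a tent function along \<open>v = (0, \<surd>N)\<close> and along all the \<open>w i\<close> produces the tile. Each of
  the \<open>N\<close> vectors \<open>w i\<close> has length at most \<open>3 \<Omega> / \<surd>N\<close>, so together they contribute as much as \<open>v\<close>
  does, up to a constant factor.\<close>

lemma compact_function_tiling_narrow_lattices:
  fixes w b :: "nat \<Rightarrow> real^2"
  assumes N: "1 \<le> N" and \<Omega>: "\<And>i. i \<in> {1..N} \<Longrightarrow> \<omega> i \<le> \<Omega>" "\<And>i. i \<in> {1..N} \<Longrightarrow> 0 < \<omega> i"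
    and wb: "\<And>i. i \<in> {1..N} \<Longrightarrow> \<bar>cross2 (w i) (b i)\<bar> = \<omega> i"
    and w: "\<And>i. i \<in> {1..N} \<Longrightarrow> w i $ 1 = \<omega> i / sqrt (real N)"
      "\<And>i. i \<in> {1..N} \<Longrightarrow> \<bar>w i $ 2\<bar> \<le> 2 * (\<omega> i / sqrt (real N))"
  obtains f where "integrable lebesgue f" "\<And>x. 0 \<le> f x"
    "\<And>i. i \<in> {1..N} \<Longrightarrow> tiles_with f (lattice_gen (w i) (b i))"
    "ess_supp f \<subseteq> cball 0 ((2 + 3 * \<Omega>) * sqrt (real N))"
proof -
  define v :: "real^2" where "v = vector [0, sqrt (real N)]"
  define ws where "ws = v # map w [1..<Suc N]"
  define g :: "real^2 \<Rightarrow> real" where "g x = max 0 (1 - norm x)" for x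
  define f where "f = foldr segment_average ws g"
  have N0: "0 < sqrt (real N)" using N by simp
  have g: "continuous_on UNIV g" "supported_in_ball 1 g" "\<And>x. 0 \<le> g x" "0 < g 0"
    by (auto simp: g_def[abs_def] supported_in_ball_def intro!: continuous_intros)
  have v: "v $ 1 = 0" "v $ 2 = sqrt (real N)" by (simp_all add: v_def)
  have w_pos: "0 < w i $ 1" if "i \<in> {1..N}" for i using w(1) \<Omega>(2) N0 that by simp
  have "v \<noteq> 0" using v(2) N0 by auto
  moreover have "w i \<noteq> 0" if "i \<in> {1..N}" for i using w_pos[OF that] by auto
  ultimately have "0 \<notin> set ws" by (fastforce simp: ws_def)
  note f = foldr_segment_average[OF g this, folded f_def]
  have "norm v = sqrt (real N)" by (simp add: norm_vec_def L2_set_def sum_2 v)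
  moreover have "(\<Sum>i\<in>{1..N}. norm (w i)) \<le> 3 * \<Omega> * sqrt (real N)"
  proof -
    have "norm (w i) \<le> 3 * \<Omega> / sqrt (real N)" if i: "i \<in> {1..N}" for i
    proof -
      have "norm (w i) \<le> \<bar>w i $ 1\<bar> + \<bar>w i $ 2\<bar>" using norm_le_l1_cart[of "w i"] by (simp add: sum_2)
      also have "\<dots> \<le> 3 * (\<omega> i / sqrt (real N))" using w[OF i] w_pos[OF i] by linarith
      also have "\<dots> \<le> 3 * \<Omega> / sqrt (real N)" using \<Omega>(1)[OF i] N0 by (simp add: divide_right_mono)
      finally show ?thesis .
    qed
    then have "(\<Sum>i\<in>{1..N}. norm (w i)) \<le> real (card {1..N}) * (3 * \<Omega> / sqrt (real N))"
      by (rule sum_bounded_above)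
    also have "\<dots> = 3 * \<Omega> * (real N / sqrt (real N))" by simp
    also have "\<dots> = 3 * \<Omega> * sqrt (real N)" by (simp only: real_div_sqrt of_nat_0_le_iff)
    finally show ?thesis .
  qed
  moreover have "sum_list (map norm ws) = norm v + (\<Sum>i\<in>{1..N}. norm (w i))"
    by (simp add: ws_def o_def sum_set_upt_conv_sum_list_nat[symmetric] atLeastLessThanSuc_atLeastAtMost del: upt_Suc)
  moreover have "1 \<le> sqrt (real N)" using N by simp
  ultimately have "1 + sum_list (map norm ws) \<le> (2 + 3 * \<Omega>) * sqrt (real N)"
    unfolding distrib_right by linarith
  then have supp: "cball 0 (1 + sum_list (map norm ws)) \<subseteq> (cball 0 ((2 + 3 * \<Omega>) * sqrt (real N)) :: (real^2) set)"
    by (intro subset_cball)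
  show ?thesis
  proof (rule that[of f])
    show "integrable lebesgue f" by (rule integrable_lebesgue_continuous_supported[OF f(1,2)])
    show "0 \<le> f x" for x by (rule f(3))
    show "ess_supp f \<subseteq> cball 0 ((2 + 3 * \<Omega>) * sqrt (real N))"
      using ess_supp_subset_cball[OF f(2)] supp by (rule subset_trans)
    fix i assume i: "i \<in> {1..N}"
    have "set ws = insert v (w ` {1..N})"
      by (simp add: ws_def atLeastLessThanSuc_atLeastAtMost del: upt_Suc)
    then have flat: "flat_along (w i) f" "flat_along v f" using f(5) i by auto
    have cross: "cross2 (w i) v = \<omega> i" using N0 by (simp add: cross2_def v w(1)[OF i])
    show "tiles_with f (lattice_gen (w i) (b i))"
      using cross wb[OF i] \<Omega>(2)[OF i] by (intro tiles_with_if_flat[OF f(2-4) flat]) auto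
  qed
qed

theorem theorem1p2:
  fixes S :: "real set"
  assumes "finite S" and "S \<noteq> {}" and "\<And>\<omega>. \<omega> \<in> S \<Longrightarrow> 0 < \<omega>"
  shows "\<exists>K>0. \<forall>(N::nat) (L :: nat \<Rightarrow> (real^2) set) (A :: nat \<Rightarrow> real^2^2).
    N \<ge> 1 \<longrightarrow>
    (\<forall>i\<in>{1..N}. full_rank_lattice (L i) \<and> lattice_volume (L i) \<in> S \<and>
                 invertible (A i) \<and> L i = lattice_of (A i)) \<longrightarrow>
    (\<forall>\<epsilon>>0. \<exists>(B :: nat \<Rightarrow> real^2^2) (C :: nat \<Rightarrow> int^2^2) (f :: real^2 \<Rightarrow> real).
       (\<forall>i\<in>{1..N}. invertible (B i) \<and> det (C i) = 1 \<and>
          det (B i) = det (A i) \<and>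
          entry_norm (B i - A i ** map_matrix real_of_int (C i)) \<le> \<epsilon>) \<and>
       (\<forall>i\<in>{1..N}. \<forall>j\<in>{1..N}. i \<noteq> j \<longrightarrow> lattice_of (B i) \<inter> lattice_of (B j) = {0}) \<and>
       integrable lebesgue f \<and> (\<forall>x. 0 \<le> f x) \<and>
       (\<forall>i\<in>{1..N}. tiles_with f (lattice_of (B i))) \<and>
       bounded (ess_supp f) \<and> diameter (ess_supp f) \<le> K * sqrt (real N))"
proof -
  define \<Omega> where "\<Omega> = Max S"
  have \<Omega>: "\<omega> \<le> \<Omega>" if "\<omega> \<in> S" for \<omega> using that assms(1) by (simp add: \<Omega>_def)
  have \<Omega>0: "0 < \<Omega>" using assms by (simp add: \<Omega>_def)
  show ?thesis
  proof (intro exI[of _ "2 * (2 + 3 * \<Omega>)"] conjI allI impI)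
    show "0 < 2 * (2 + 3 * \<Omega>)" using \<Omega>0 by simp
  next
    fix N :: nat and L :: "nat \<Rightarrow> (real^2) set" and A :: "nat \<Rightarrow> real^2^2" and \<epsilon> :: real
    assume N: "1 \<le> N" and \<epsilon>: "0 < \<epsilon>"
      and L: "\<forall>i\<in>{1..N}. full_rank_lattice (L i) \<and> lattice_volume (L i) \<in> S \<and>
                 invertible (A i) \<and> L i = lattice_of (A i)"
    have A: "invertible (A i)" if "i \<in> {1..N}" for i using L that by blast
    have vol: "\<bar>det (A i)\<bar> \<in> S" if "i \<in> {1..N}" for i
      using L that lattice_volume_lattice_of[OF A[OF that]] by metis
    have \<eta>: "0 < 1 / sqrt (real N)" using N by simp
    obtain B C w b where BC: "\<forall>i\<in>{1..N}. det (C i) = 1 \<and> det (B i) = det (A i) \<and>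
       entry_norm (B i - A i ** map_matrix real_of_int (C i)) \<le> \<epsilon> \<and>
       lattice_of (B i) = lattice_gen (w i) (b i) \<and> cross2 (w i) (b i) = det (A i) \<and>
       w i $ 1 = \<bar>det (A i)\<bar> * (1 / sqrt (real N)) \<and>
       \<bar>w i $ 2\<bar> \<le> 2 * (\<bar>det (A i)\<bar> * (1 / sqrt (real N)))"
      and disj: "\<forall>i\<in>{1..N}. \<forall>j\<in>{1..N}. i \<noteq> j \<longrightarrow>
        lattice_of (B i) \<inter> lattice_of (B j) = {0}"
      by (rule disjoint_narrow_lattices[OF A \<eta> \<epsilon>])
    obtain f where f: "integrable lebesgue f" "\<And>x. 0 \<le> f x"
      "\<And>i. i \<in> {1..N} \<Longrightarrow> tiles_with f (lattice_gen (w i) (b i))"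
      "ess_supp f \<subseteq> cball 0 ((2 + 3 * \<Omega>) * sqrt (real N))"
      using compact_function_tiling_narrow_lattices[of N "\<lambda>i. \<bar>det (A i)\<bar>" \<Omega> w b]
        N BC \<Omega>[OF vol] assms(3)[OF vol] by auto
    have "diameter (ess_supp f) \<le> diameter (cball 0 ((2 + 3 * \<Omega>) * sqrt (real N)) :: (real^2) set)"
      by (intro diameter_subset f(4) bounded_cball)
    also have "\<dots> \<le> 2 * (2 + 3 * \<Omega>) * sqrt (real N)"
      using \<Omega>0 by (simp add: algebra_simps)
    finally have diam: "diameter (ess_supp f) \<le> 2 * (2 + 3 * \<Omega>) * sqrt (real N)" .
    have inv: "invertible (B i)" if "i \<in> {1..N}" for i
      using BC A[OF that] that by (simp add: invertible_det_nz)
    show "\<exists>B C f. (\<forall>i\<in>{1..N}. invertible (B i) \<and> det (C i) = 1 \<and>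
          det (B i) = det (A i) \<and>
          entry_norm (B i - A i ** map_matrix real_of_int (C i)) \<le> \<epsilon>) \<and>
       (\<forall>i\<in>{1..N}. \<forall>j\<in>{1..N}. i \<noteq> j \<longrightarrow> lattice_of (B i) \<inter> lattice_of (B j) = {0}) \<and>
       integrable lebesgue f \<and> (\<forall>x. 0 \<le> f x) \<and>
       (\<forall>i\<in>{1..N}. tiles_with f (lattice_of (B i))) \<and>
       bounded (ess_supp f) \<and> diameter (ess_supp f) \<le> 2 * (2 + 3 * \<Omega>) * sqrt (real N)"
      using BC disj f(1-3) diam inv bounded_subset[OF bounded_cball f(4)]
      by (intro exI[of _ B] exI[of _ C] exI[of _ f]) simp
  qed
qed

end
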